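(* $\mathsf{Syn}^-$ is sound and complete with respect to $\delta$-models: for every formula $\varphi$, $\varphi$ is derivable in $\mathsf{Syn}^-$ if and only if $\varphi$ is true at every world of every $\delta$-model.
   Context: Fix a finite set $\mathsf{Ag}$ of agents; an agent pattern is a set $G\subseteq\mathcal{P}(\mathsf{Ag})\setminus\{\emptyset\}$. Formulas: $\varphi::= p\mid\neg\varphi\mid\varphi\wedge\varphi\mid [G]\varphi$ ($p$ in a countable set $\mathsf{Prop}$, $G$ an agent pattern); $\bot:=p\wedge\neg p$ for fixed $p$; $\mathsf{alive}(G):=\neg[G]\bot$. $\mathsf{Syn}^-$ has axioms: all propositional tautologies; (K) $[G](\varphi\to\psi)\to([G]\varphi\to[G]\psi)$; (B) $\varphi\to[G]\neg[G]\neg\varphi$; (4) $[G]\varphi\to[G][G]\varphi$; (T) $\mathsf{alive}(G)\to([G]\varphi\to\varphi)$; (NE) $\bigvee_{G}\mathsf{alive}(G)$ over all agent patterns; (Mono) $[G]\varphi\to[H]\varphi$ if $G\subseteq H$; (Equiv) $[G\cup\{B\}]\varphi\to[G]\varphi$ if some $A\in G$ has $B\subseteq A$ ($B\ne\emptyset$); (Union) $\mathsf{alive}(G)\wedge\mathsf{alive}(H)\to\mathsf{alive}(G\cup H)$; (Clo) $\mathsf{alive}(G)\to\mathsf{alive}(\{A\cup B\})$ for $A,B\in G$; rules modus ponens and $[G]$-necessitation. A pre-model $\mathcal{M}=(W,\sim,V)$ consists of a set $W$, a function assigning to each agent pattern $G$ a symmetric and transitive relation $\sim_G$ on $W$, and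 $V:W\to\mathcal{P}(\mathsf{Prop})$. Truth: $\mathcal{M},w\Vdash p$ iff $p\in V(w)$; Boolean clauses as usual; $\mathcal{M},w\Vdash[G]\varphi$ iff $\mathcal{M},v\Vdash\varphi$ for all $v$ with $w\sim_G v$. $\mathsf{alive}(G)_\mathcal{M}=\{w\mid w\sim_G w\}$. A $\delta$-model is a pre-model such that for all agent patterns $G,H$: (K2) $\mathsf{alive}(G)_\mathcal{M}\subseteq\mathsf{alive}(\{A\cup B\})_\mathcal{M}$ for $A,B\in G$; (K3) $\sim_H\subseteq\sim_G$ if $G\subseteq H$; (K4) $\sim_G\subseteq\sim_{G\cup\{B\}}$ if some $A\in G$ has $\emptyset\ne B\subseteq A$; (NE) every $w$ has some $G$ with $w\sim_G w$; (D) $\sim_G=\bigcap_{B\in G}\sim_{\{B\}}$. *)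

theory Defs
  imports "HOL-Library.Countable"
begin

definition agent_patterns :: "'a set \<Rightarrow> 'a set set set" where
  "agent_patterns Ag = Pow (Pow Ag - {{}})"

datatype ('a, 'p) fm =
    Atom 'p
  | Neg "('a, 'p) fm"
  | Conj "('a, 'p) fm" "('a, 'p) fm"
  | Box "'a set set" "('a, 'p) fm"

text \<open>The datatype admits arbitrary sets of sets under a box; the formulas of the language over
  \<open>Ag\<close> are those in which only agent patterns occur.\<close>

primrec is_formula :: "'a set \<Rightarrow> ('a, 'p) fm \<Rightarrow> bool" where
  "is_formula Ag (Atom p) \<longleftrightarrow> True"
| "is_formula Ag (Neg \<phi>) \<longleftrightarrow> is_formula Ag \<phi>"
| "is_formula Ag (Conj \<phi> \<psi>) \<longleftrightarrow> is_formula Ag \<phi> \<and> is_formula Ag \<psi>"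
| "is_formula Ag (Box G \<phi>) \<longleftrightarrow> G \<in> agent_patterns Ag \<and> is_formula Ag \<phi>"

definition Disj :: "('a, 'p) fm \<Rightarrow> ('a, 'p) fm \<Rightarrow> ('a, 'p) fm" where
  "Disj \<phi> \<psi> = Neg (Conj (Neg \<phi>) (Neg \<psi>))"

definition Imp :: "('a, 'p) fm \<Rightarrow> ('a, 'p) fm \<Rightarrow> ('a, 'p) fm" where
  "Imp \<phi> \<psi> = Neg (Conj \<phi> (Neg \<psi>))"

text \<open>The parameter \<open>p0\<close> is the fixed atom used to express falsity.\<close>

definition Bot :: "'p \<Rightarrow> ('a, 'p) fm" where
  "Bot p0 = Conj (Atom p0) (Neg (Atom p0))"

definition alive :: "'p \<Rightarrow> 'a set set \<Rightarrow> ('a, 'p) fm" where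
  "alive p0 G = Neg (Box G (Bot p0))"

fun Disj_list :: "'p \<Rightarrow> ('a, 'p) fm list \<Rightarrow> ('a, 'p) fm" where
  "Disj_list p0 [] = Bot p0"
| "Disj_list p0 [\<phi>] = \<phi>"
| "Disj_list p0 (\<phi> # \<psi> # \<chi>s) = Disj \<phi> (Disj_list p0 (\<psi> # \<chi>s))"

text \<open>Propositional tautologies are instances in the modal language: boxed formulas are evaluated
  like atoms, by an arbitrary truth assignment.\<close>

primrec prop_eval :: "(('a, 'p) fm \<Rightarrow> bool) \<Rightarrow> ('a, 'p) fm \<Rightarrow> bool" where
  "prop_eval v (Atom p) \<longleftrightarrow> v (Atom p)"
| "prop_eval v (Neg \<phi>) \<longleftrightarrow> \<not> prop_eval v \<phi>"
| "prop_eval v (Conj \<phi> \<psi>) \<longleftrightarrow> prop_eval v \<phi> \<and> prop_eval v \<psi>"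
| "prop_eval v (Box G \<phi>) \<longleftrightarrow> v (Box G \<phi>)"

definition tautology :: "('a, 'p) fm \<Rightarrow> bool" where
  "tautology \<phi> \<longleftrightarrow> (\<forall>v. prop_eval v \<phi>)"

text \<open>In \<open>NE\<close> the disjunction over the finite set of all agent patterns is taken along an arbitrary
  enumeration without repetition.\<close>

inductive Syn_minus :: "'a set \<Rightarrow> 'p \<Rightarrow> ('a, 'p) fm \<Rightarrow> bool" for Ag :: "'a set" and p0 :: 'p where
  Taut: "is_formula Ag \<phi> \<Longrightarrow> tautology \<phi> \<Longrightarrow> Syn_minus Ag p0 \<phi>"
| K: "G \<in> agent_patterns Ag \<Longrightarrow> is_formula Ag \<phi> \<Longrightarrow> is_formula Ag \<psi> \<Longrightarrow>
    Syn_minus Ag p0 (Imp (Box G (Imp \<phi> \<psi>)) (Imp (Box G \<phi>) (Box G \<psi>)))"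
| B: "G \<in> agent_patterns Ag \<Longrightarrow> is_formula Ag \<phi> \<Longrightarrow>
    Syn_minus Ag p0 (Imp \<phi> (Box G (Neg (Box G (Neg \<phi>)))))"
| Four: "G \<in> agent_patterns Ag \<Longrightarrow> is_formula Ag \<phi> \<Longrightarrow>
    Syn_minus Ag p0 (Imp (Box G \<phi>) (Box G (Box G \<phi>)))"
| T: "G \<in> agent_patterns Ag \<Longrightarrow> is_formula Ag \<phi> \<Longrightarrow>
    Syn_minus Ag p0 (Imp (alive p0 G) (Imp (Box G \<phi>) \<phi>))"
| NE: "distinct Gs \<Longrightarrow> set Gs = agent_patterns Ag \<Longrightarrow>
    Syn_minus Ag p0 (Disj_list p0 (map (alive p0) Gs))"
| Mono: "G \<in> agent_patterns Ag \<Longrightarrow> H \<in> agent_patterns Ag \<Longrightarrow> G \<subseteq> H \<Longrightarrow> is_formula Ag \<phi> \<Longrightarrow>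
    Syn_minus Ag p0 (Imp (Box G \<phi>) (Box H \<phi>))"
| Equiv: "G \<in> agent_patterns Ag \<Longrightarrow> A \<in> G \<Longrightarrow> B \<subseteq> A \<Longrightarrow> B \<noteq> {} \<Longrightarrow> is_formula Ag \<phi> \<Longrightarrow>
    Syn_minus Ag p0 (Imp (Box (G \<union> {B}) \<phi>) (Box G \<phi>))"
| Union: "G \<in> agent_patterns Ag \<Longrightarrow> H \<in> agent_patterns Ag \<Longrightarrow>
    Syn_minus Ag p0 (Imp (Conj (alive p0 G) (alive p0 H)) (alive p0 (G \<union> H)))"
| Clo: "G \<in> agent_patterns Ag \<Longrightarrow> A \<in> G \<Longrightarrow> B \<in> G \<Longrightarrow>
    Syn_minus Ag p0 (Imp (alive p0 G) (alive p0 {A \<union> B}))"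
| MP: "Syn_minus Ag p0 \<phi> \<Longrightarrow> Syn_minus Ag p0 (Imp \<phi> \<psi>) \<Longrightarrow> Syn_minus Ag p0 \<psi>"
| Nec: "G \<in> agent_patterns Ag \<Longrightarrow> Syn_minus Ag p0 \<phi> \<Longrightarrow> Syn_minus Ag p0 (Box G \<phi>)"

record ('w, 'a, 'p) model =
  worlds :: "'w set"
  rel :: "'a set set \<Rightarrow> ('w \<times> 'w) set"
  val :: "'w \<Rightarrow> 'p set"

definition pre_model :: "'a set \<Rightarrow> ('w, 'a, 'p) model \<Rightarrow> bool" where
  "pre_model Ag M \<longleftrightarrow>
    (\<forall>G \<in> agent_patterns Ag. rel M G \<subseteq> worlds M \<times> worlds M \<and> sym (rel M G) \<and> trans (rel M G))"

primrec sat :: "('w, 'a, 'p) model \<Rightarrow> 'w \<Rightarrow> ('a, 'p) fm \<Rightarrow> bool" where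
  "sat M w (Atom p) \<longleftrightarrow> p \<in> val M w"
| "sat M w (Neg \<phi>) \<longleftrightarrow> \<not> sat M w \<phi>"
| "sat M w (Conj \<phi> \<psi>) \<longleftrightarrow> sat M w \<phi> \<and> sat M w \<psi>"
| "sat M w (Box G \<phi>) \<longleftrightarrow> (\<forall>v. (w, v) \<in> rel M G \<longrightarrow> sat M v \<phi>)"

definition alive_set :: "('w, 'a, 'p) model \<Rightarrow> 'a set set \<Rightarrow> 'w set" where
  "alive_set M G = {w \<in> worlds M. (w, w) \<in> rel M G}"

text \<open>In the last condition the intersection is taken among relations on the set of worlds, so
  that for the empty agent pattern it is the total relation on the worlds.\<close>

definition delta_model :: "'a set \<Rightarrow> ('w, 'a, 'p) model \<Rightarrow> bool" where
  "delta_model Ag M \<longleftrightarrow>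
    pre_model Ag M \<and>
    (\<forall>G \<in> agent_patterns Ag. \<forall>A \<in> G. \<forall>B \<in> G. alive_set M G \<subseteq> alive_set M {A \<union> B}) \<and>
    (\<forall>G \<in> agent_patterns Ag. \<forall>H \<in> agent_patterns Ag. G \<subseteq> H \<longrightarrow> rel M H \<subseteq> rel M G) \<and>
    (\<forall>G \<in> agent_patterns Ag. \<forall>A \<in> G. \<forall>B. B \<noteq> {} \<and> B \<subseteq> A \<longrightarrow> rel M G \<subseteq> rel M (G \<union> {B})) \<and>
    (\<forall>w \<in> worlds M. \<exists>G \<in> agent_patterns Ag. (w, w) \<in> rel M G) \<and>
    (\<forall>G \<in> agent_patterns Ag. rel M G = (worlds M \<times> worlds M) \<inter> (\<Inter>B \<in> G. rel M {B}))"

end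

theory Submission
  imports Defs "HOL-Library.Equipollence"
begin

text \<open>
  Completeness. Maximal consistent theories with their canonical relations satisfy every
  condition on \<open>\<delta>\<close>-models except (D): two theories may be related by every \<open>{B}\<close> with \<open>B \<in> G\<close>
  without being related by \<open>G\<close>. Therefore the canonical model is unravelled into a tree, in which
  each edge carries the pattern \<open>H\<close> of the refuted box \<open>[H]\<psi>\<close> that created it. Two nodes are
  \<open>G\<close>-related if both are alive for \<open>G\<close> and climbing towards the root along edges whose pattern
  covers \<open>G\<close> leads to the same node; by (Equiv) and (Mono) the theories at the two nodes are then
  \<open>G\<close>-related. As for (D), aliveness for \<open>G\<close> amounts to aliveness for each \<open>{B}\<close> by (Union), and
  the climb for \<open>G\<close> stops where the first of the climbs for \<open>{B}\<close> stops: paths in a tree being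
  unique, two nodes whose climbs meet for every \<open>B \<in> G\<close> have climbs that meet for \<open>G\<close>. Closure
  under unions (Clo) only concerns aliveness, which the tree inherits from the theories. Only the
  finitely many boxes in the formula need witnesses, so the tree is countable, and it can be pulled
  back along a surjection from any infinite type.
\<close>

section \<open>Agent patterns\<close>

lemma finite_agent_patterns: "finite Ag \<Longrightarrow> finite (agent_patterns Ag)"
  by (simp add: agent_patterns_def)

lemma finite_agent_pattern: "finite Ag \<Longrightarrow> G \<in> agent_patterns Ag \<Longrightarrow> finite G"
  unfolding agent_patterns_def by (meson Diff_subset PowD finite_Pow_iff finite_subset)

lemma empty_agent_pattern [simp]: "{} \<in> agent_patterns Ag"
  by (simp add: agent_patterns_def)

lemma insert_agent_pattern [simp]:
  "insert B G \<in> agent_patterns Ag \<longleftrightarrow> B \<subseteq> Ag \<and> B \<noteq> {} \<and> G \<in> agent_patterns Ag"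
  by (auto simp: agent_patterns_def)

lemma Un_agent_pattern [simp]:
  "G \<union> H \<in> agent_patterns Ag \<longleftrightarrow> G \<in> agent_patterns Ag \<and> H \<in> agent_patterns Ag"
  by (auto simp: agent_patterns_def)

lemma agent_patternD:
  assumes "G \<in> agent_patterns Ag" "B \<in> G"
  shows "B \<subseteq> Ag" "B \<noteq> {}"
  using assms by (auto simp: agent_patterns_def)

lemma singleton_agent_pattern:
  "G \<in> agent_patterns Ag \<Longrightarrow> B \<in> G \<Longrightarrow> {B} \<in> agent_patterns Ag"
  by (simp add: agent_patternD)

definition covers :: "'a set set \<Rightarrow> 'a set set \<Rightarrow> bool" where
  "covers H G \<longleftrightarrow> (\<forall>B \<in> G. \<exists>A \<in> H. B \<subseteq> A)"

lemma covers_simps [simp]: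
  "covers H {}"
  "covers H (insert B G) \<longleftrightarrow> (\<exists>A \<in> H. B \<subseteq> A) \<and> covers H G"
  by (auto simp: covers_def)

lemma covers_iff_singletons: "covers H G \<longleftrightarrow> (\<forall>B \<in> G. covers H {B})"
  by (simp add: covers_def)

lemma covers_superset: "G \<subseteq> H \<Longrightarrow> covers H G"
  by (auto simp: covers_def)

lemma covers_trans: "covers H G \<Longrightarrow> covers G F \<Longrightarrow> covers H F"
  unfolding covers_def by (meson subset_trans)

section \<open>Formulas\<close>

lemma is_formula_simps [simp]:
  "is_formula Ag (Imp \<phi> \<psi>) \<longleftrightarrow> is_formula Ag \<phi> \<and> is_formula Ag \<psi>"
  "is_formula Ag (Disj \<phi> \<psi>) \<longleftrightarrow> is_formula Ag \<phi> \<and> is_formula Ag \<psi>"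
  "is_formula Ag (Bot p0)"
  "is_formula Ag (alive p0 G) \<longleftrightarrow> G \<in> agent_patterns Ag"
  by (auto simp: Imp_def Disj_def Bot_def alive_def)

lemma is_formula_Disj_list [simp]:
  "is_formula Ag (Disj_list p0 \<phi>s) \<longleftrightarrow> (\<forall>\<phi> \<in> set \<phi>s. is_formula Ag \<phi>)"
  by (induction p0 \<phi>s rule: Disj_list.induct) auto

lemma prop_eval_simps [simp]:
  "prop_eval v (Imp \<phi> \<psi>) \<longleftrightarrow> (prop_eval v \<phi> \<longrightarrow> prop_eval v \<psi>)"
  "\<not> prop_eval v (Bot p0)"
  by (auto simp: Imp_def Bot_def)

lemma sat_simps [simp]:
  "sat M w (Imp \<phi> \<psi>) \<longleftrightarrow> (sat M w \<phi> \<longrightarrow> sat M w \<psi>)"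
  "sat M w (Disj \<phi> \<psi>) \<longleftrightarrow> sat M w \<phi> \<or> sat M w \<psi>"
  "\<not> sat M w (Bot p0)"
  by (auto simp: Imp_def Disj_def Bot_def)

lemma sat_Disj_list [simp]: "sat M w (Disj_list p0 \<phi>s) \<longleftrightarrow> (\<exists>\<phi> \<in> set \<phi>s. sat M w \<phi>)"
  by (induction p0 \<phi>s rule: Disj_list.induct) auto

lemma prop_eval_sat: "prop_eval (sat M w) \<phi> \<longleftrightarrow> sat M w \<phi>"
  by (induction \<phi>) auto

lemma Syn_minus_is_formula: "Syn_minus Ag p0 \<phi> \<Longrightarrow> is_formula Ag \<phi>"
proof (induction rule: Syn_minus.induct)
  case (Equiv G A B \<phi>)
  then show ?case using agent_patternD(1)[of G Ag A] by auto
next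
  case (Clo G A B)
  then show ?case using agent_patternD[of G Ag A] agent_patternD[of G Ag B] by auto
qed auto

primrec boxes :: "('a, 'p) fm \<Rightarrow> ('a set set \<times> ('a, 'p) fm) set" where
  "boxes (Atom p) = {}"
| "boxes (Neg \<phi>) = boxes \<phi>"
| "boxes (Conj \<phi> \<psi>) = boxes \<phi> \<union> boxes \<psi>"
| "boxes (Box G \<phi>) = insert (G, \<phi>) (boxes \<phi>)"

lemma finite_boxes: "finite (boxes \<phi>)"
  by (induction \<phi>) auto

lemma is_formula_boxes:
  "is_formula Ag \<phi> \<Longrightarrow> (G, \<psi>) \<in> boxes \<phi> \<Longrightarrow> is_formula Ag (Box G \<psi>)"
  by (induction \<phi>) auto

section \<open>Models and soundness\<close>

lemma pre_modelD:
  assumes "pre_model Ag M" "G \<in> agent_patterns Ag"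
  shows "rel M G \<subseteq> worlds M \<times> worlds M" "sym (rel M G)" "trans (rel M G)"
  using assms by (auto simp: pre_model_def)

lemma sat_alive:
  assumes "pre_model Ag M" "G \<in> agent_patterns Ag"
  shows "sat M w (alive p0 G) \<longleftrightarrow> (w, w) \<in> rel M G"
  using pre_modelD(2,3)[OF assms] by (simp add: alive_def) (meson symD transD)

lemma
  assumes "delta_model Ag M"
  shows delta_model_pre_model: "pre_model Ag M"
    and delta_model_alive_set_Un:
      "G \<in> agent_patterns Ag \<Longrightarrow> A \<in> G \<Longrightarrow> B \<in> G \<Longrightarrow> alive_set M G \<subseteq> alive_set M {A \<union> B}"
    and delta_model_rel_antimono:
      "G \<in> agent_patterns Ag \<Longrightarrow> H \<in> agent_patterns Ag \<Longrightarrow> G \<subseteq> H \<Longrightarrow> rel M H \<subseteq> rel M G"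
    and delta_model_rel_insert_subset:
      "G \<in> agent_patterns Ag \<Longrightarrow> A \<in> G \<Longrightarrow> B \<noteq> {} \<Longrightarrow> B \<subseteq> A \<Longrightarrow> rel M G \<subseteq> rel M (G \<union> {B})"
    and delta_model_ex_alive: "w \<in> worlds M \<Longrightarrow> \<exists>G \<in> agent_patterns Ag. (w, w) \<in> rel M G"
    and delta_model_rel_eq:
      "G \<in> agent_patterns Ag \<Longrightarrow> rel M G = (worlds M \<times> worlds M) \<inter> (\<Inter>B \<in> G. rel M {B})"
  using assms unfolding delta_model_def by metis+

lemma delta_model_rel_Un:
  assumes "delta_model Ag M" "G \<in> agent_patterns Ag" "H \<in> agent_patterns Ag"
  shows "rel M (G \<union> H) = rel M G \<inter> rel M H"
  using delta_model_rel_eq[OF assms(1,2)] delta_model_rel_eq[OF assms(1,3)]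
    delta_model_rel_eq[OF assms(1), of "G \<union> H"] assms(2,3) by auto

theorem Syn_minus_sound:
  assumes M: "delta_model Ag M"
  shows "Syn_minus Ag p0 \<phi> \<Longrightarrow> w \<in> worlds M \<Longrightarrow> sat M w \<phi>"
proof (induction arbitrary: w rule: Syn_minus.induct)
  note pre = delta_model_pre_model[OF M]
  note sat_alive = sat_alive[OF pre]
  {
    case (Taut \<phi>)
    then show ?case by (metis prop_eval_sat tautology_def)
  next
    case (B G \<phi>)
    then show ?case using pre_modelD(2)[OF pre] by simp (meson symD)
  next
    case (Four G \<phi>)
    then show ?case using pre_modelD(3)[OF pre] by simp (meson transD)
  next
    case (T G \<phi>)
    then show ?case by (auto simp: sat_alive)
  next
    case (NE Gs)
    then show ?case using delta_model_ex_alive[OF M] by (auto simp: sat_alive)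
  next
    case (Mono G H \<phi>)
    then show ?case using delta_model_rel_antimono[OF M, of G H] by auto
  next
    case (Equiv G A B \<phi>)
    then show ?case using delta_model_rel_insert_subset[OF M, of G A B] by auto
  next
    case (Union G H)
    then show ?case using delta_model_rel_Un[OF M, of G H] by (auto simp: sat_alive)
  next
    case (Clo G A B)
    then have "{A \<union> B} \<in> agent_patterns Ag"
      using agent_patternD[of G Ag A] agent_patternD[of G Ag B] by auto
    then show ?case
      using Clo delta_model_alive_set_Un[OF M, of G A B] by (auto simp: sat_alive alive_set_def)
  next
    case (Nec G \<phi>)
    then show ?case using pre_modelD(1)[OF pre] by auto
  }
qed auto

section \<open>Changing the type of worlds\<close>

definition pullback_model :: "('v \<Rightarrow> 'w) \<Rightarrow> ('w, 'a, 'p) model \<Rightarrow> ('v, 'a, 'p) model" where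
  "pullback_model g M =
    \<lparr>worlds = g -` worlds M, rel = (\<lambda>G. inv_image (rel M G) g), val = val M \<circ> g\<rparr>"

lemma pullback_model_simps [simp]:
  "worlds (pullback_model g M) = g -` worlds M"
  "rel (pullback_model g M) G = inv_image (rel M G) g"
  "val (pullback_model g M) = val M \<circ> g"
  by (simp_all add: pullback_model_def)

lemma alive_set_pullback_model [simp]: "alive_set (pullback_model g M) G = g -` alive_set M G"
  by (auto simp: alive_set_def)

lemma sat_pullback_model:
  assumes "pre_model Ag M" "worlds M \<subseteq> range g"
  shows "is_formula Ag \<phi> \<Longrightarrow> sat (pullback_model g M) x \<phi> \<longleftrightarrow> sat M (g x) \<phi>"
proof (induction \<phi> arbitrary: x)
  case (Box G \<phi>)
  then have "\<exists>y. v = g y" if "(g x, v) \<in> rel M G" for v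
    using pre_modelD(1)[OF assms(1), of G] assms(2) that by auto
  then show ?case using Box by auto
qed auto

lemma pre_model_pullback_model:
  assumes "pre_model Ag M"
  shows "pre_model Ag (pullback_model g M)"
  unfolding pre_model_def pullback_model_simps
proof (intro ballI conjI)
  fix G assume "G \<in> agent_patterns Ag"
  note rel = pre_modelD[OF assms this]
  show "inv_image (rel M G) g \<subseteq> g -` worlds M \<times> g -` worlds M" using rel(1) by auto
  show "sym (inv_image (rel M G) g)" using rel(2) by (rule sym_inv_image)
  show "trans (inv_image (rel M G) g)" using rel(3) by (rule trans_inv_image)
qed

lemma delta_model_pullback_model:
  assumes M: "delta_model Ag M"
  shows "delta_model Ag (pullback_model g M)"
  unfolding delta_model_def pullback_model_simps alive_set_pullback_model
proof (intro conjI ballI allI impI; (elim conjE)?)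
  show "pre_model Ag (pullback_model g M)"
    using delta_model_pre_model[OF M] by (rule pre_model_pullback_model)
next
  fix G A B assume "G \<in> agent_patterns Ag" "A \<in> G" "B \<in> G"
  then show "g -` alive_set M G \<subseteq> g -` alive_set M {A \<union> B}"
    by (intro vimage_mono delta_model_alive_set_Un[OF M])
next
  fix G H assume "G \<in> agent_patterns Ag" "H \<in> agent_patterns Ag" "G \<subseteq> H"
  then have "rel M H \<subseteq> rel M G" by (rule delta_model_rel_antimono[OF M])
  then show "inv_image (rel M H) g \<subseteq> inv_image (rel M G) g" by auto
next
  fix G A B assume "G \<in> agent_patterns Ag" "A \<in> G" "B \<noteq> {}" "B \<subseteq> A"
  then have "rel M G \<subseteq> rel M (G \<union> {B})" by (rule delta_model_rel_insert_subset[OF M])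
  then show "inv_image (rel M G) g \<subseteq> inv_image (rel M (G \<union> {B})) g" by auto
next
  fix x assume "x \<in> g -` worlds M"
  then show "\<exists>G \<in> agent_patterns Ag. (x, x) \<in> inv_image (rel M G) g"
    using delta_model_ex_alive[OF M] by simp
next
  fix G assume "G \<in> agent_patterns Ag"
  then have "inv_image (rel M G) g = inv_image ((worlds M \<times> worlds M) \<inter> (\<Inter>B \<in> G. rel M {B})) g"
    by (rule arg_cong[OF delta_model_rel_eq[OF M]])
  also have "\<dots> = (g -` worlds M \<times> g -` worlds M) \<inter> (\<Inter>B \<in> G. inv_image (rel M {B}) g)"
    by auto
  finally show "inv_image (rel M G) g =
      (g -` worlds M \<times> g -` worlds M) \<inter> (\<Inter>B \<in> G. inv_image (rel M {B}) g)" .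
qed

theorem delta_model_on_infinite_type:
  fixes M :: "('v, 'a, 'p) model"
  assumes M: "delta_model Ag M" "countable (worlds M)" and w: "w \<in> worlds M"
    and "infinite (UNIV :: 'w set)"
  obtains N :: "('w, 'a, 'p) model" and x where "delta_model Ag N" "x \<in> worlds N"
    "\<And>\<phi>. is_formula Ag \<phi> \<Longrightarrow> sat N x \<phi> \<longleftrightarrow> sat M w \<phi>"
proof -
  have "worlds M \<lesssim> (UNIV :: nat set)"
    using M(2) by (auto simp: countable_def lepoll_def)
  also have "\<dots> \<lesssim> (UNIV :: 'w set)"
    using assms(4) by (simp add: infinite_le_lepoll)
  finally obtain g :: "'w \<Rightarrow> 'v" where g: "worlds M \<subseteq> range g"
    unfolding lepoll_iff by blast
  then obtain x where x: "g x = w" using w by auto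
  show thesis
  proof (rule that)
    show "delta_model Ag (pullback_model g M)" using M(1) by (rule delta_model_pullback_model)
    show "x \<in> worlds (pullback_model g M)" using x w by simp
    show "sat (pullback_model g M) x \<phi> \<longleftrightarrow> sat M w \<phi>" if "is_formula Ag \<phi>" for \<phi>
      using sat_pullback_model[OF delta_model_pre_model[OF M(1)] g that] x by metis
  qed
qed

section \<open>Closed theories\<close>

locale closed_theory =
  fixes Ag :: "'a set" and p0 :: 'p and \<Gamma> :: "('a, 'p) fm set"
  assumes formula: "\<phi> \<in> \<Gamma> \<Longrightarrow> is_formula Ag \<phi>"
    and derivable: "Syn_minus Ag p0 \<phi> \<Longrightarrow> \<phi> \<in> \<Gamma>"
    and modus_ponens: "\<phi> \<in> \<Gamma> \<Longrightarrow> Imp \<phi> \<psi> \<in> \<Gamma> \<Longrightarrow> \<psi> \<in> \<Gamma>"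
begin

lemma derivable_Imp:
  assumes "Syn_minus Ag p0 (Imp \<phi> \<psi>)" "\<phi> \<in> \<Gamma>"
  shows "\<psi> \<in> \<Gamma>"
  using assms(2) derivable[OF assms(1)] by (rule modus_ponens)

lemma tautology_mem: "is_formula Ag \<phi> \<Longrightarrow> tautology \<phi> \<Longrightarrow> \<phi> \<in> \<Gamma>"
  by (simp add: derivable Taut)

lemma propositional_consequence:
  assumes "\<phi> \<in> \<Gamma>" "\<psi> \<in> \<Gamma>" "is_formula Ag \<chi>"
    and "\<And>v. prop_eval v \<phi> \<Longrightarrow> prop_eval v \<psi> \<Longrightarrow> prop_eval v \<chi>"
  shows "\<chi> \<in> \<Gamma>"
proof -
  have "Imp \<phi> (Imp \<psi> \<chi>) \<in> \<Gamma>"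
    using formula[OF assms(1)] formula[OF assms(2)] assms(3,4)
    by (intro tautology_mem) (simp_all add: tautology_def)
  then show ?thesis by (rule modus_ponens[OF assms(2) modus_ponens[OF assms(1)]])
qed

lemma Imp_mem: "is_formula Ag \<phi> \<Longrightarrow> \<psi> \<in> \<Gamma> \<Longrightarrow> Imp \<phi> \<psi> \<in> \<Gamma>"
  using propositional_consequence[of \<psi> \<psi> "Imp \<phi> \<psi>"] formula by simp

lemma closed_theory_Imp:
  assumes \<phi>: "is_formula Ag \<phi>"
  shows "closed_theory Ag p0 {\<psi>. Imp \<phi> \<psi> \<in> \<Gamma>}"
proof (unfold_locales, unfold mem_Collect_eq)
  show "is_formula Ag \<psi>" if "Imp \<phi> \<psi> \<in> \<Gamma>" for \<psi>
    using formula[OF that] by simp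
  show "Imp \<phi> \<psi> \<in> \<Gamma>" if "Syn_minus Ag p0 \<psi>" for \<psi>
    using \<phi> derivable[OF that] by (rule Imp_mem)
  show "Imp \<phi> \<chi> \<in> \<Gamma>" if "Imp \<phi> \<psi> \<in> \<Gamma>" "Imp \<phi> (Imp \<psi> \<chi>) \<in> \<Gamma>" for \<psi> \<chi>
    using formula[OF that(2)] by (intro propositional_consequence[OF that]) auto
qed

lemma closed_theory_Box:
  assumes G: "G \<in> agent_patterns Ag"
  shows "closed_theory Ag p0 {\<psi>. Box G \<psi> \<in> \<Gamma>}"
proof (unfold_locales, unfold mem_Collect_eq)
  show "is_formula Ag \<psi>" if "Box G \<psi> \<in> \<Gamma>" for \<psi>
    using formula[OF that] by simp
  show "Box G \<psi> \<in> \<Gamma>" if "Syn_minus Ag p0 \<psi>" for \<psi>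
    using Nec[OF G that] by (rule derivable)
  show "Box G \<chi> \<in> \<Gamma>" if "Box G \<psi> \<in> \<Gamma>" "Box G (Imp \<psi> \<chi>) \<in> \<Gamma>" for \<psi> \<chi>
    using formula[OF that(2)] by (intro modus_ponens[OF that(1) derivable_Imp[OF K that(2)]]) auto
qed

lemma Box_Box: "Box G \<phi> \<in> \<Gamma> \<Longrightarrow> Box G (Box G \<phi>) \<in> \<Gamma>"
  using formula[of "Box G \<phi>"] derivable_Imp[OF Four] by simp

lemma Box_aliveD: "alive p0 G \<in> \<Gamma> \<Longrightarrow> Box G \<phi> \<in> \<Gamma> \<Longrightarrow> \<phi> \<in> \<Gamma>"
  using formula[of "Box G \<phi>"] derivable_Imp[OF T, of G \<phi>] modus_ponens[of "Box G \<phi>" \<phi>] by simp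

lemma Box_mono: "Box G \<phi> \<in> \<Gamma> \<Longrightarrow> G \<subseteq> H \<Longrightarrow> H \<in> agent_patterns Ag \<Longrightarrow> Box H \<phi> \<in> \<Gamma>"
  using formula[of "Box G \<phi>"] derivable_Imp[OF Mono, of G H \<phi>] by simp

lemma alive_Un: "alive p0 G \<in> \<Gamma> \<Longrightarrow> A \<in> G \<Longrightarrow> B \<in> G \<Longrightarrow> alive p0 {A \<union> B} \<in> \<Gamma>"
  using formula[of "alive p0 G"] derivable_Imp[OF Clo, of G A B] by simp

lemma Box_Un_covers:
  "finite G \<Longrightarrow> covers H G \<Longrightarrow> Box (H \<union> G) \<phi> \<in> \<Gamma> \<Longrightarrow> Box H \<phi> \<in> \<Gamma>"
proof (induction G rule: finite_induct)
  case (insert B G)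
  then obtain A where A: "A \<in> H \<union> G" "B \<subseteq> A" by auto
  have "Box ((H \<union> G) \<union> {B}) \<phi> \<in> \<Gamma>" using insert.prems(2) by simp
  then have "Box (H \<union> G) \<phi> \<in> \<Gamma>"
    using formula[OF insert.prems(2)] derivable_Imp[OF Equiv[OF _ A]] by simp
  then show ?case using insert by simp
qed simp

lemma Box_covers:
  assumes "finite G" "H \<in> agent_patterns Ag" "covers H G" "Box G \<phi> \<in> \<Gamma>"
  shows "Box H \<phi> \<in> \<Gamma>"
proof (rule Box_Un_covers)
  show "Box (H \<union> G) \<phi> \<in> \<Gamma>"
    using Box_mono[OF assms(4), of "H \<union> G"] formula[OF assms(4)] assms(2) by simp
qed fact+

end

lemma closed_theory_Syn_minus: "closed_theory Ag p0 {\<phi>. Syn_minus Ag p0 \<phi>}"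
  by unfold_locales (auto simp: Syn_minus_is_formula intro: MP)

lemma closed_theory_Union_chain:
  assumes "C \<noteq> {}" and C: "subset.chain {\<Gamma>. closed_theory Ag p0 \<Gamma>} C"
  shows "closed_theory Ag p0 (\<Union>C)"
proof
  have closed: "closed_theory Ag p0 \<Gamma>" if "\<Gamma> \<in> C" for \<Gamma>
    using C that by (auto simp: subset_chain_def)
  show "is_formula Ag \<phi>" if "\<phi> \<in> \<Union>C" for \<phi>
    using that by (auto intro: closed_theory.formula[OF closed])
  show "\<phi> \<in> \<Union>C" if "Syn_minus Ag p0 \<phi>" for \<phi>
    using assms(1) that by (auto intro: closed_theory.derivable[OF closed])
  fix \<phi> \<psi> assume "\<phi> \<in> \<Union>C" "Imp \<phi> \<psi> \<in> \<Union>C"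
  then obtain \<Gamma> \<Delta> where "\<Gamma> \<in> C" "\<phi> \<in> \<Gamma>" "\<Delta> \<in> C" "Imp \<phi> \<psi> \<in> \<Delta>" by blast
  moreover from this have "\<Gamma> \<subseteq> \<Delta> \<or> \<Delta> \<subseteq> \<Gamma>" using C by (simp add: subset_chain_def)
  ultimately obtain \<Theta> where \<Theta>: "\<Theta> \<in> C" "\<phi> \<in> \<Theta>" "Imp \<phi> \<psi> \<in> \<Theta>" by blast
  have "\<psi> \<in> \<Theta>" using closed[OF \<Theta>(1)] \<Theta>(2,3) by (rule closed_theory.modus_ponens)
  then show "\<psi> \<in> \<Union>C" using \<Theta>(1) by (rule UnionI[rotated])
qed

section \<open>Maximal consistent theories\<close>

locale maximal_consistent = closed_theory +
  assumes Neg_iff: "is_formula Ag \<phi> \<Longrightarrow> Neg \<phi> \<in> \<Gamma> \<longleftrightarrow> \<phi> \<notin> \<Gamma>"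
begin

lemma Conj_iff:
  assumes "is_formula Ag \<phi>" "is_formula Ag \<psi>"
  shows "Conj \<phi> \<psi> \<in> \<Gamma> \<longleftrightarrow> \<phi> \<in> \<Gamma> \<and> \<psi> \<in> \<Gamma>"
proof (intro iffI conjI; (elim conjE)?)
  assume conj: "Conj \<phi> \<psi> \<in> \<Gamma>"
  show "\<phi> \<in> \<Gamma>" by (rule propositional_consequence[OF conj conj assms(1)]) simp
  show "\<psi> \<in> \<Gamma>" by (rule propositional_consequence[OF conj conj assms(2)]) simp
next
  assume "\<phi> \<in> \<Gamma>" "\<psi> \<in> \<Gamma>"
  then show "Conj \<phi> \<psi> \<in> \<Gamma>" by (rule propositional_consequence) (use assms in simp_all)
qed

lemma Disj_iff:
  "is_formula Ag \<phi> \<Longrightarrow> is_formula Ag \<psi> \<Longrightarrow> Disj \<phi> \<psi> \<in> \<Gamma> \<longleftrightarrow> \<phi> \<in> \<Gamma> \<or> \<psi> \<in> \<Gamma>"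
  by (simp add: Disj_def Neg_iff Conj_iff)

lemma Bot_not_mem: "Bot p \<notin> \<Gamma>"
  by (simp add: Bot_def Neg_iff Conj_iff)

lemma Disj_list_iff:
  "\<forall>\<phi> \<in> set \<phi>s. is_formula Ag \<phi> \<Longrightarrow> Disj_list p \<phi>s \<in> \<Gamma> \<longleftrightarrow> (\<exists>\<phi> \<in> set \<phi>s. \<phi> \<in> \<Gamma>)"
  by (induction p \<phi>s rule: Disj_list.induct) (auto simp: Bot_not_mem Disj_iff)

lemma alive_iff: "G \<in> agent_patterns Ag \<Longrightarrow> alive p0 G \<in> \<Gamma> \<longleftrightarrow> Box G (Bot p0) \<notin> \<Gamma>"
  by (simp add: alive_def Neg_iff)

lemma alive_covers:
  assumes "finite G" "G \<in> agent_patterns Ag" "covers H G" "alive p0 H \<in> \<Gamma>"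
  shows "alive p0 G \<in> \<Gamma>"
  using assms formula[OF assms(4)] Box_covers[of G H "Bot p0"] by (auto simp: alive_iff)

lemma alive_empty:
  assumes "finite Ag"
  shows "alive p0 {} \<in> \<Gamma>"
proof -
  obtain Gs where Gs: "set Gs = agent_patterns Ag" "distinct Gs"
    using finite_distinct_list finite_agent_patterns[OF assms] by blast
  then have "Disj_list p0 (map (alive p0) Gs) \<in> \<Gamma>"
    by (intro derivable NE)
  then obtain G where "alive p0 G \<in> \<Gamma>"
    using Gs(1) by (auto simp: Disj_list_iff)
  then show ?thesis using alive_covers[of "{}" G] by simp
qed

lemma alive_iff_singletons:
  assumes "finite Ag" and G: "G \<in> agent_patterns Ag"
  shows "alive p0 G \<in> \<Gamma> \<longleftrightarrow> (\<forall>B \<in> G. alive p0 {B} \<in> \<Gamma>)"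
proof (rule iffI, rule ballI)
  fix B assume "alive p0 G \<in> \<Gamma>" "B \<in> G"
  then show "alive p0 {B} \<in> \<Gamma>"
    using singleton_agent_pattern[OF G] by (intro alive_covers[of "{B}" G] covers_superset) auto
next
  have "finite G" using assms by (rule finite_agent_pattern)
  then show "\<forall>B \<in> G. alive p0 {B} \<in> \<Gamma> \<Longrightarrow> alive p0 G \<in> \<Gamma>"
    using G
  proof (induction G rule: finite_induct)
    case empty
    show ?case using assms(1) by (rule alive_empty)
  next
    case (insert B G)
    then have "Conj (alive p0 {B}) (alive p0 G) \<in> \<Gamma>" by (simp add: Conj_iff)
    then show ?case using derivable_Imp[OF Union, of "{B}" G] insert.prems by simp
  qed
qed

end

lemma maximal_consistent_if_maximal_omitting:
  assumes "closed_theory Ag p0 \<Gamma>" and \<chi>: "is_formula Ag \<chi>" "\<chi> \<notin> \<Gamma>"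
    and max: "\<And>\<Delta>. closed_theory Ag p0 \<Delta> \<Longrightarrow> \<Gamma> \<subseteq> \<Delta> \<Longrightarrow> \<chi> \<notin> \<Delta> \<Longrightarrow> \<Delta> = \<Gamma>"
  shows "maximal_consistent Ag p0 \<Gamma>"
proof -
  interpret closed_theory Ag p0 \<Gamma> by fact
  have Imp_if_not_mem: "Imp \<phi> \<chi> \<in> \<Gamma>" if \<phi>: "is_formula Ag \<phi>" "\<phi> \<notin> \<Gamma>" for \<phi>
  proof (rule ccontr)
    assume "Imp \<phi> \<chi> \<notin> \<Gamma>"
    then have "{\<psi>. Imp \<phi> \<psi> \<in> \<Gamma>} = \<Gamma>"
      using \<phi>(1) Imp_mem by (intro max closed_theory_Imp) auto
    moreover have "Imp \<phi> \<phi> \<in> \<Gamma>"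
      using \<phi>(1) by (intro tautology_mem) (auto simp: tautology_def)
    ultimately show False using \<phi>(2) by blast
  qed
  show ?thesis
  proof (unfold_locales, rule iffI)
    fix \<phi> assume "Neg \<phi> \<in> \<Gamma>"
    then show "\<phi> \<notin> \<Gamma>" using propositional_consequence[of \<phi> "Neg \<phi>" \<chi>] \<chi> by auto
  next
    fix \<phi> assume \<phi>: "is_formula Ag \<phi>" "\<phi> \<notin> \<Gamma>"
    show "Neg \<phi> \<in> \<Gamma>"
    proof (rule ccontr)
      assume "Neg \<phi> \<notin> \<Gamma>"
      then have "Imp \<phi> \<chi> \<in> \<Gamma>" "Imp (Neg \<phi>) \<chi> \<in> \<Gamma>" using \<phi> Imp_if_not_mem by simp_all
      then have "\<chi> \<in> \<Gamma>" by (rule propositional_consequence) (use \<chi>(1) in auto)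
      then show False using \<chi>(2) by contradiction
    qed
  qed
qed

theorem Lindenbaum:
  assumes "closed_theory Ag p0 \<Gamma>" and \<chi>: "is_formula Ag \<chi>" "\<chi> \<notin> \<Gamma>"
  obtains \<Delta> where "maximal_consistent Ag p0 \<Delta>" "\<Gamma> \<subseteq> \<Delta>" "\<chi> \<notin> \<Delta>"
proof -
  let ?S = "{\<Delta>. closed_theory Ag p0 \<Delta> \<and> \<Gamma> \<subseteq> \<Delta> \<and> \<chi> \<notin> \<Delta>}"
  have "\<exists>\<Delta> \<in> ?S. \<forall>\<Theta> \<in> ?S. \<Delta> \<subseteq> \<Theta> \<longrightarrow> \<Theta> = \<Delta>"
  proof (rule subset_Zorn_nonempty)
    show "?S \<noteq> {}" using assms by blast
  next
    fix C assume "C \<noteq> {}" and C: "subset.chain ?S C"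
    then have "closed_theory Ag p0 (\<Union>C)"
      by (intro closed_theory_Union_chain) (auto simp: subset_chain_def)
    then show "\<Union>C \<in> ?S" using \<open>C \<noteq> {}\<close> C by (auto simp: subset_chain_def)
  qed
  then obtain \<Delta> where \<Delta>: "\<Delta> \<in> ?S" and max: "\<And>\<Theta>. \<Theta> \<in> ?S \<Longrightarrow> \<Delta> \<subseteq> \<Theta> \<Longrightarrow> \<Theta> = \<Delta>"
    by (elim bexE) blast
  have "maximal_consistent Ag p0 \<Delta>"
    using \<Delta> \<chi>(1) by (intro maximal_consistent_if_maximal_omitting[where \<chi> = \<chi>] max) auto
  with \<Delta> show thesis by (intro that) auto
qed

section \<open>The canonical relations\<close>

definition canonical_rel :: "'a set set \<Rightarrow> ('a, 'p) fm set \<Rightarrow> ('a, 'p) fm set \<Rightarrow> bool" where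
  "canonical_rel G \<Gamma> \<Delta> \<longleftrightarrow> (\<forall>\<phi>. Box G \<phi> \<in> \<Gamma> \<longrightarrow> \<phi> \<in> \<Delta>)"

lemma canonical_relD: "canonical_rel G \<Gamma> \<Delta> \<Longrightarrow> Box G \<phi> \<in> \<Gamma> \<Longrightarrow> \<phi> \<in> \<Delta>"
  by (simp add: canonical_rel_def)

context closed_theory
begin

lemma canonical_rel_refl: "alive p0 G \<in> \<Gamma> \<Longrightarrow> canonical_rel G \<Gamma> \<Gamma>"
  unfolding canonical_rel_def by (metis Box_aliveD)

lemma canonical_rel_trans:
  "canonical_rel G \<Gamma> \<Delta> \<Longrightarrow> canonical_rel G \<Delta> \<Theta> \<Longrightarrow> canonical_rel G \<Gamma> \<Theta>"
  unfolding canonical_rel_def by (metis Box_Box)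

lemma canonical_rel_covers:
  assumes "finite G" "H \<in> agent_patterns Ag" "covers H G" "canonical_rel H \<Gamma> \<Delta>"
  shows "canonical_rel G \<Gamma> \<Delta>"
  using assms unfolding canonical_rel_def by (metis Box_covers)

lemma canonical_rel_witness:
  assumes "is_formula Ag (Box G \<psi>)" "Box G \<psi> \<notin> \<Gamma>"
  obtains \<Delta> where "maximal_consistent Ag p0 \<Delta>" "canonical_rel G \<Gamma> \<Delta>" "\<psi> \<notin> \<Delta>"
proof -
  have "closed_theory Ag p0 {\<chi>. Box G \<chi> \<in> \<Gamma>}"
    using assms(1) by (intro closed_theory_Box) simp
  moreover have "is_formula Ag \<psi>" "\<psi> \<notin> {\<chi>. Box G \<chi> \<in> \<Gamma>}" using assms by simp_all
  ultimately obtain \<Delta> where "maximal_consistent Ag p0 \<Delta>" "{\<chi>. Box G \<chi> \<in> \<Gamma>} \<subseteq> \<Delta>" "\<psi> \<notin> \<Delta>"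
    by (rule Lindenbaum)
  then show thesis by (intro that) (auto simp: canonical_rel_def)
qed

end

context maximal_consistent
begin

lemma canonical_rel_sym:
  assumes "closed_theory Ag p0 \<Delta>" "Bot p0 \<notin> \<Delta>" and G: "G \<in> agent_patterns Ag"
    and rel: "canonical_rel G \<Gamma> \<Delta>"
  shows "canonical_rel G \<Delta> \<Gamma>"
  unfolding canonical_rel_def
proof (intro allI impI, rule ccontr)
  interpret \<Delta>: closed_theory Ag p0 \<Delta> by fact
  interpret Box_\<Delta>: closed_theory Ag p0 "{\<psi>. Box G \<psi> \<in> \<Delta>}" using G by (rule \<Delta>.closed_theory_Box)
  fix \<phi> assume box: "Box G \<phi> \<in> \<Delta>" and "\<phi> \<notin> \<Gamma>"
  have \<phi>: "is_formula Ag \<phi>" using \<Delta>.formula[OF box] by simp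
  then have "Neg \<phi> \<in> \<Gamma>" using \<open>\<phi> \<notin> \<Gamma>\<close> by (simp add: Neg_iff)
  then have "Box G (Neg (Box G (Neg (Neg \<phi>)))) \<in> \<Gamma>"
    using derivable_Imp[OF B[OF G]] \<phi> by simp
  then have "Neg (Box G (Neg (Neg \<phi>))) \<in> \<Delta>" using rel by (rule canonical_relD[rotated])
  moreover have "Box G (Neg (Neg \<phi>)) \<in> \<Delta>"
    using Box_\<Delta>.propositional_consequence[of \<phi> \<phi> "Neg (Neg \<phi>)"] box \<phi> by simp
  ultimately have "Bot p0 \<in> \<Delta>" by (rule \<Delta>.propositional_consequence) simp_all
  then show False using assms(2) by contradiction
qed

lemma canonical_rel_alive:
  assumes "G \<in> agent_patterns Ag" "canonical_rel G \<Gamma> \<Delta>" "Bot p0 \<notin> \<Delta>"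
  shows "alive p0 G \<in> \<Gamma>"
  using assms by (auto simp: alive_iff dest: canonical_relD)

end

section \<open>Climbing towards the root\<close>

lemma dropWhile_dropWhile_weaker:
  "(\<And>x. P x \<Longrightarrow> Q x) \<Longrightarrow> dropWhile Q (dropWhile P xs) = dropWhile Q xs"
  by (induction xs) auto

lemma dropWhile_ball_eqI:
  assumes eq: "\<And>i. i \<in> I \<Longrightarrow> dropWhile (P i) xs = dropWhile (P i) ys"
  shows "dropWhile (\<lambda>x. \<forall>i \<in> I. P i x) xs = dropWhile (\<lambda>x. \<forall>i \<in> I. P i x) ys"
proof (cases "I = {}")
  case True
  then have "dropWhile (\<lambda>x. \<forall>i \<in> I. P i x) zs = []" for zs by simp
  then show ?thesis by (simp only:)
next
  case False
  let ?drop = "dropWhile (\<lambda>x. \<forall>i \<in> I. P i x)"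
  have stop: "\<exists>i \<in> I. dropWhile (P i) zs = ?drop zs" for zs
    using False by (induction zs) auto
  have suffix: "dropWhile (P i) (?drop zs) = dropWhile (P i) zs" if "i \<in> I" for i zs
    using that by (intro dropWhile_dropWhile_weaker) auto
  obtain i where "i \<in> I" "dropWhile (P i) xs = ?drop xs" using stop by blast
  then have xs: "?drop xs = dropWhile (P i) (?drop ys)" using eq suffix by simp
  obtain j where "j \<in> I" "dropWhile (P j) ys = ?drop ys" using stop by blast
  then have ys: "?drop ys = dropWhile (P j) (?drop xs)" using eq suffix by simp
  have "length (?drop xs) = length (?drop ys)"
    using length_dropWhile_le[of "P i" "?drop ys"] length_dropWhile_le[of "P j" "?drop xs"]
    unfolding xs[symmetric] ys[symmetric] by (rule order_antisym)
  moreover have "takeWhile (P i) (?drop ys) @ ?drop xs = [] @ ?drop ys" using xs by simp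
  ultimately show ?thesis using append_eq_append_conv by blast
qed

text \<open>A node is the list of boxes refuted on the way from the root to it, the most recent one
  first.\<close>

type_synonym ('a, 'p) path = "('a set set \<times> ('a, 'p) fm) list"

definition climb :: "'a set set \<Rightarrow> ('a, 'p) path \<Rightarrow> ('a, 'p) path" where
  "climb G = dropWhile (\<lambda>e. covers (fst e) G)"

lemma climb_simps [simp]:
  "climb G [] = []"
  "climb G ((H, \<psi>) # l) = (if covers H G then climb G l else (H, \<psi>) # l)"
  by (simp_all add: climb_def)

lemma climb_climb_covers: "covers H G \<Longrightarrow> climb G (climb H l) = climb G l"
  unfolding climb_def by (rule dropWhile_dropWhile_weaker) (auto intro: covers_trans)

lemma climb_eqI:
  fixes l l' :: "('a, 'p) path"
  assumes "\<And>B. B \<in> G \<Longrightarrow> climb {B} l = climb {B} l'"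
  shows "climb G l = climb G l'"
proof -
  have "climb G m = dropWhile (\<lambda>e. \<forall>B \<in> G. covers (fst e) {B}) m" for m :: "('a, 'p) path"
    unfolding climb_def by (subst covers_iff_singletons) (rule refl)
  moreover have "dropWhile (\<lambda>e. \<forall>B \<in> G. covers (fst e) {B}) l =
      dropWhile (\<lambda>e. \<forall>B \<in> G. covers (fst e) {B}) l'"
    using assms unfolding climb_def by (rule dropWhile_ball_eqI)
  ultimately show ?thesis by (simp only:)
qed

section \<open>The unravelled model\<close>

locale unravelling =
  fixes Ag :: "'a set" and p0 :: 'p and \<Gamma> :: "('a, 'p) fm set"
    and E :: "('a set set \<times> ('a, 'p) fm) set"
  assumes finite_agents: "finite Ag" and root: "maximal_consistent Ag p0 \<Gamma>"
    and edge_formula: "(H, \<psi>) \<in> E \<Longrightarrow> is_formula Ag (Box H \<psi>)"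
begin

primrec theory_at :: "('a, 'p) path \<Rightarrow> ('a, 'p) fm set" where
  "theory_at [] = \<Gamma>"
| "theory_at (e # l) = (SOME \<Delta>.
    maximal_consistent Ag p0 \<Delta> \<and> canonical_rel (fst e) (theory_at l) \<Delta> \<and> snd e \<notin> \<Delta>)"

inductive_set nodes :: "('a, 'p) path set" where
  Nil: "[] \<in> nodes"
| Cons: "l \<in> nodes \<Longrightarrow> (H, \<psi>) \<in> E \<Longrightarrow> Box H \<psi> \<notin> theory_at l \<Longrightarrow> (H, \<psi>) # l \<in> nodes"

lemma countable_nodes:
  assumes "countable E"
  shows "countable nodes"
proof (rule countable_subset)
  have "l \<in> nodes \<Longrightarrow> l \<in> lists E" for l by (induction rule: nodes.induct) auto
  then show "nodes \<subseteq> lists E" by blast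
  show "countable (lists E)" using assms by (rule countable_lists)
qed

lemma theory_at_Cons:
  assumes "maximal_consistent Ag p0 (theory_at l)" "(H, \<psi>) \<in> E" "Box H \<psi> \<notin> theory_at l"
  shows "maximal_consistent Ag p0 (theory_at ((H, \<psi>) # l)) \<and>
    canonical_rel H (theory_at l) (theory_at ((H, \<psi>) # l)) \<and> \<psi> \<notin> theory_at ((H, \<psi>) # l)"
proof -
  interpret maximal_consistent Ag p0 "theory_at l" by fact
  obtain \<Delta> where "maximal_consistent Ag p0 \<Delta> \<and> canonical_rel H (theory_at l) \<Delta> \<and> \<psi> \<notin> \<Delta>"
    using canonical_rel_witness[OF edge_formula[OF assms(2)] assms(3)] by blast
  then show ?thesis unfolding theory_at.simps fst_conv snd_conv by (rule someI)
qed

lemma maximal_consistent_theory_at: "l \<in> nodes \<Longrightarrow> maximal_consistent Ag p0 (theory_at l)"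
proof (induction rule: nodes.induct)
  case Nil
  then show ?case using root by simp
next
  case (Cons l H \<psi>)
  then show ?case using theory_at_Cons by blast
qed

lemma edgeD:
  assumes "(H, \<psi>) # l \<in> nodes"
  shows "l \<in> nodes" "H \<in> agent_patterns Ag"
    "canonical_rel H (theory_at l) (theory_at ((H, \<psi>) # l))" "\<psi> \<notin> theory_at ((H, \<psi>) # l)"
proof -
  from assms have edge: "l \<in> nodes" "(H, \<psi>) \<in> E" "Box H \<psi> \<notin> theory_at l"
    by (auto elim: nodes.cases)
  show "l \<in> nodes" by (rule edge(1))
  show "H \<in> agent_patterns Ag" using edge_formula[OF edge(2)] by simp
  show "canonical_rel H (theory_at l) (theory_at ((H, \<psi>) # l))" "\<psi> \<notin> theory_at ((H, \<psi>) # l)"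
    using theory_at_Cons[OF maximal_consistent_theory_at[OF edge(1)] edge(2,3)] by simp_all
qed

lemma canonical_rel_sym_nodes:
  assumes "l \<in> nodes" "l' \<in> nodes" "G \<in> agent_patterns Ag"
    and "canonical_rel G (theory_at l) (theory_at l')"
  shows "canonical_rel G (theory_at l') (theory_at l)"
proof -
  interpret l: maximal_consistent Ag p0 "theory_at l"
    using assms(1) by (rule maximal_consistent_theory_at)
  interpret l': maximal_consistent Ag p0 "theory_at l'"
    using assms(2) by (rule maximal_consistent_theory_at)
  show ?thesis
    using l'.closed_theory_axioms l'.Bot_not_mem assms(3,4) by (rule l.canonical_rel_sym)
qed

lemma climb_nodes: "l \<in> nodes \<Longrightarrow> climb G l \<in> nodes"
  by (induction rule: nodes.induct) (auto intro: nodes.intros)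

lemma canonical_rel_climb:
  assumes G: "G \<in> agent_patterns Ag"
  shows "l \<in> nodes \<Longrightarrow> alive p0 G \<in> theory_at l \<Longrightarrow>
    canonical_rel G (theory_at l) (theory_at (climb G l))"
proof (induction rule: nodes.induct)
  case Nil
  interpret maximal_consistent Ag p0 \<Gamma> by (rule root)
  show ?case using Nil canonical_rel_refl by simp
next
  case (Cons l H \<psi>)
  let ?l' = "(H, \<psi>) # l"
  have l': "?l' \<in> nodes" using Cons.hyps by (rule nodes.Cons)
  interpret l: maximal_consistent Ag p0 "theory_at l"
    using Cons.hyps(1) by (rule maximal_consistent_theory_at)
  interpret l': maximal_consistent Ag p0 "theory_at ?l'"
    using l' by (rule maximal_consistent_theory_at)
  show ?case
  proof (cases "covers H G")
    case True
    then have down: "canonical_rel G (theory_at l) (theory_at ?l')"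
      using finite_agent_pattern[OF finite_agents G] edgeD(2,3)[OF l']
      by (intro l.canonical_rel_covers[of G H])
    then have "canonical_rel G (theory_at l) (theory_at (climb G l))"
      using Cons.IH l.canonical_rel_alive[OF G] l'.Bot_not_mem by blast
    moreover have "canonical_rel G (theory_at ?l') (theory_at l)"
      using Cons.hyps(1) l' G down by (rule canonical_rel_sym_nodes)
    ultimately show ?thesis using True l'.canonical_rel_trans by simp
  next
    case False
    then show ?thesis using Cons.prems l'.canonical_rel_refl by simp
  qed
qed

definition tree :: "(('a, 'p) path, 'a, 'p) model" where
  "tree = \<lparr>worlds = nodes,
    rel = (\<lambda>G. {(l, l') \<in> nodes \<times> nodes.
      alive p0 G \<in> theory_at l \<and> alive p0 G \<in> theory_at l' \<and> climb G l = climb G l'}),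
    val = (\<lambda>l. {p. Atom p \<in> theory_at l})\<rparr>"

lemma worlds_tree [simp]: "worlds tree = nodes"
  by (simp add: tree_def)

lemma rel_tree_iff:
  "(l, l') \<in> rel tree G \<longleftrightarrow> l \<in> nodes \<and> l' \<in> nodes \<and>
    alive p0 G \<in> theory_at l \<and> alive p0 G \<in> theory_at l' \<and> climb G l = climb G l'"
  by (simp add: tree_def)

lemma alive_set_tree: "alive_set tree G = {l \<in> nodes. alive p0 G \<in> theory_at l}"
  by (auto simp: alive_set_def rel_tree_iff)

lemma rel_tree_covers:
  assumes G: "G \<in> agent_patterns Ag" and "covers H G"
  shows "rel tree H \<subseteq> rel tree G"
proof (rule subrelI)
  fix l l' assume rel: "(l, l') \<in> rel tree H"
  have "alive p0 G \<in> theory_at m" if "m \<in> nodes" "alive p0 H \<in> theory_at m" for m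
  proof -
    interpret maximal_consistent Ag p0 "theory_at m"
      using that(1) by (rule maximal_consistent_theory_at)
    show ?thesis
      using finite_agent_pattern[OF finite_agents G] G assms(2) that(2) by (rule alive_covers)
  qed
  moreover have "climb G l = climb G l'"
    using rel climb_climb_covers[OF assms(2)] unfolding rel_tree_iff by metis
  ultimately show "(l, l') \<in> rel tree G" using rel by (simp add: rel_tree_iff)
qed

lemma rel_tree_eq_Inter:
  assumes G: "G \<in> agent_patterns Ag"
  shows "rel tree G = (nodes \<times> nodes) \<inter> (\<Inter>B \<in> G. rel tree {B})"
proof (intro subset_antisym subrelI)
  fix l l' assume rel: "(l, l') \<in> rel tree G"
  then have "(l, l') \<in> rel tree {B}" if "B \<in> G" for B
    using rel_tree_covers[OF singleton_agent_pattern[OF G that] covers_superset] that by blast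
  then show "(l, l') \<in> (nodes \<times> nodes) \<inter> (\<Inter>B \<in> G. rel tree {B})"
    using rel by (simp add: rel_tree_iff)
next
  fix l l' assume "(l, l') \<in> (nodes \<times> nodes) \<inter> (\<Inter>B \<in> G. rel tree {B})"
  then have nodes: "l \<in> nodes" "l' \<in> nodes" and rel: "\<forall>B \<in> G. (l, l') \<in> rel tree {B}" by auto
  interpret l: maximal_consistent Ag p0 "theory_at l"
    using nodes(1) by (rule maximal_consistent_theory_at)
  interpret l': maximal_consistent Ag p0 "theory_at l'"
    using nodes(2) by (rule maximal_consistent_theory_at)
  have "alive p0 G \<in> theory_at l" "alive p0 G \<in> theory_at l'"
    using rel unfolding rel_tree_iff l.alive_iff_singletons[OF finite_agents G]
      l'.alive_iff_singletons[OF finite_agents G] by blast+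
  moreover have "climb G l = climb G l'"
    by (rule climb_eqI) (use rel in \<open>simp add: rel_tree_iff\<close>)
  ultimately show "(l, l') \<in> rel tree G" using nodes by (simp add: rel_tree_iff)
qed

theorem delta_model_tree: "delta_model Ag tree"
  unfolding delta_model_def worlds_tree
proof (intro conjI ballI allI impI; (elim conjE)?)
  show "pre_model Ag tree"
    unfolding pre_model_def by (auto simp: rel_tree_iff intro!: symI transI)
next
  fix G A B assume "G \<in> agent_patterns Ag" and AB: "A \<in> G" "B \<in> G"
  show "alive_set tree G \<subseteq> alive_set tree {A \<union> B}"
  proof
    fix l assume "l \<in> alive_set tree G"
    then have l: "l \<in> nodes" "alive p0 G \<in> theory_at l" by (simp_all add: alive_set_tree)
    interpret maximal_consistent Ag p0 "theory_at l"
      using l(1) by (rule maximal_consistent_theory_at)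
    show "l \<in> alive_set tree {A \<union> B}"
      using l(1) alive_Un[OF l(2) AB] by (simp add: alive_set_tree)
  qed
next
  fix G H assume "G \<in> agent_patterns Ag" "G \<subseteq> H"
  then show "rel tree H \<subseteq> rel tree G" by (intro rel_tree_covers covers_superset)
next
  fix G A B assume "G \<in> agent_patterns Ag" "A \<in> G" "B \<noteq> {}" "B \<subseteq> A"
  then show "rel tree G \<subseteq> rel tree (G \<union> {B})"
    using agent_patternD(1)[of G Ag A] by (intro rel_tree_covers) (auto simp: covers_superset)
next
  fix l assume "l \<in> nodes"
  then have "(l, l) \<in> rel tree {}" by (simp add: rel_tree_eq_Inter)
  then show "\<exists>G \<in> agent_patterns Ag. (l, l) \<in> rel tree G" using empty_agent_pattern by blast
qed (rule rel_tree_eq_Inter)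

lemma rel_tree_edge:
  assumes edge: "(H, \<psi>) # l \<in> nodes"
  shows "(l, (H, \<psi>) # l) \<in> rel tree H"
proof -
  let ?l' = "(H, \<psi>) # l"
  note edgeD = edgeD[OF edge]
  interpret l: maximal_consistent Ag p0 "theory_at l"
    using edgeD(1) by (rule maximal_consistent_theory_at)
  interpret l': maximal_consistent Ag p0 "theory_at ?l'"
    using edge by (rule maximal_consistent_theory_at)
  have "alive p0 H \<in> theory_at l"
    using edgeD(2,3) l'.Bot_not_mem by (rule l.canonical_rel_alive)
  moreover have "alive p0 H \<in> theory_at ?l'"
    using edgeD(2) canonical_rel_sym_nodes[OF edgeD(1) edge edgeD(2,3)] l.Bot_not_mem
    by (rule l'.canonical_rel_alive)
  moreover have "climb H l = climb H ?l'" by (simp add: covers_superset)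
  ultimately show ?thesis using edge edgeD(1) unfolding rel_tree_iff by blast
qed

lemma canonical_rel_tree:
  assumes G: "G \<in> agent_patterns Ag" and rel: "(l, l') \<in> rel tree G"
  shows "canonical_rel G (theory_at l) (theory_at l')"
proof -
  have l: "l \<in> nodes" "alive p0 G \<in> theory_at l"
    and l': "l' \<in> nodes" "alive p0 G \<in> theory_at l'" and climb: "climb G l = climb G l'"
    using rel by (auto simp: rel_tree_iff)
  interpret maximal_consistent Ag p0 "theory_at l"
    using l(1) by (rule maximal_consistent_theory_at)
  have "canonical_rel G (theory_at l) (theory_at (climb G l))"
    using G l by (rule canonical_rel_climb)
  moreover have "canonical_rel G (theory_at (climb G l)) (theory_at l')"
    using l'(1) climb_nodes[OF l(1)] G canonical_rel_climb[OF G l', folded climb]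
    by (rule canonical_rel_sym_nodes)
  ultimately show ?thesis by (rule canonical_rel_trans)
qed

lemma Box_mem_theory_at_iff:
  assumes "is_formula Ag (Box G \<phi>)" "(G, \<phi>) \<in> E" "l \<in> nodes"
  shows "Box G \<phi> \<in> theory_at l \<longleftrightarrow> (\<forall>l'. (l, l') \<in> rel tree G \<longrightarrow> \<phi> \<in> theory_at l')"
proof (intro iffI allI impI)
  fix l' assume box: "Box G \<phi> \<in> theory_at l" and "(l, l') \<in> rel tree G"
  then have "canonical_rel G (theory_at l) (theory_at l')"
    using assms(1) by (intro canonical_rel_tree) simp_all
  then show "\<phi> \<in> theory_at l'" using box by (rule canonical_relD)
next
  assume succ: "\<forall>l'. (l, l') \<in> rel tree G \<longrightarrow> \<phi> \<in> theory_at l'"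
  show "Box G \<phi> \<in> theory_at l"
  proof (rule ccontr)
    assume "Box G \<phi> \<notin> theory_at l"
    with assms(3,2) have "(G, \<phi>) # l \<in> nodes" by (rule nodes.Cons)
    then show False using succ rel_tree_edge edgeD(4) by blast
  qed
qed

theorem sat_tree_iff:
  "is_formula Ag \<phi> \<Longrightarrow> boxes \<phi> \<subseteq> E \<Longrightarrow> l \<in> nodes \<Longrightarrow> sat tree l \<phi> \<longleftrightarrow> \<phi> \<in> theory_at l"
proof (induction \<phi> arbitrary: l)
  case (Atom p)
  then show ?case by (simp add: tree_def)
next
  case (Neg \<phi>)
  then show ?case using maximal_consistent.Neg_iff[OF maximal_consistent_theory_at] by simp
next
  case (Conj \<phi> \<psi>)
  then show ?case using maximal_consistent.Conj_iff[OF maximal_consistent_theory_at] by simp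
next
  case (Box G \<phi>)
  then have "sat tree l' \<phi> \<longleftrightarrow> \<phi> \<in> theory_at l'" if "(l, l') \<in> rel tree G" for l'
    using that by (simp add: rel_tree_iff)
  then show ?case using Box.prems Box_mem_theory_at_iff[of G \<phi> l] by simp
qed

end

section \<open>Completeness\<close>

theorem countable_countermodel:
  assumes "finite Ag" and \<phi>: "is_formula Ag \<phi>" "\<not> Syn_minus Ag p0 \<phi>"
  obtains M :: "(('a, 'p) path, 'a, 'p) model" and w
  where "delta_model Ag M" "countable (worlds M)" "w \<in> worlds M" "\<not> sat M w \<phi>"
proof -
  obtain \<Gamma> where \<Gamma>: "maximal_consistent Ag p0 \<Gamma>" "\<phi> \<notin> \<Gamma>"
    using Lindenbaum[OF closed_theory_Syn_minus \<phi>(1), of p0] \<phi>(2) by auto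
  interpret unravelling Ag p0 \<Gamma> "boxes \<phi>"
    using assms(1) \<Gamma>(1) is_formula_boxes[OF \<phi>(1)] by (rule unravelling.intro)
  show thesis
  proof (rule that)
    show "delta_model Ag tree" by (rule delta_model_tree)
    show "countable (worlds tree)"
      using countable_nodes[OF countable_finite[OF finite_boxes]] by simp
    show "[] \<in> worlds tree" by (simp add: nodes.Nil)
    show "\<not> sat tree [] \<phi>" using sat_tree_iff[OF \<phi>(1) _ nodes.Nil] \<Gamma>(2) by simp
  qed
qed

theorem theorem5p37:
  fixes Ag :: "'a set" and p0 :: "'p::countable" and \<phi> :: "('a, 'p) fm"
  assumes "finite Ag"
    and "infinite (UNIV :: 'w set)"
    and "is_formula Ag \<phi>"
  shows "Syn_minus Ag p0 \<phi> \<longleftrightarrow>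
    (\<forall>M :: ('w, 'a, 'p) model. delta_model Ag M \<longrightarrow> (\<forall>w \<in> worlds M. sat M w \<phi>))"
proof (intro iffI allI impI ballI)
  fix M :: "('w, 'a, 'p) model" and w
  assume "Syn_minus Ag p0 \<phi>" "delta_model Ag M" "w \<in> worlds M"
  then show "sat M w \<phi>" by (intro Syn_minus_sound)
next
  assume valid: "\<forall>M :: ('w, 'a, 'p) model. delta_model Ag M \<longrightarrow> (\<forall>w \<in> worlds M. sat M w \<phi>)"
  show "Syn_minus Ag p0 \<phi>"
  proof (rule ccontr)
    assume "\<not> Syn_minus Ag p0 \<phi>"
    with assms(1,3) obtain M :: "(('a, 'p) path, 'a, 'p) model" and w
      where M: "delta_model Ag M" "countable (worlds M)" "w \<in> worlds M" "\<not> sat M w \<phi>"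
      by (rule countable_countermodel)
    obtain N :: "('w, 'a, 'p) model" and x where "delta_model Ag N" "x \<in> worlds N"
      "\<And>\<psi>. is_formula Ag \<psi> \<Longrightarrow> sat N x \<psi> \<longleftrightarrow> sat M w \<psi>"
      using M(1-3) assms(2) by (rule delta_model_on_infinite_type) blast
    then show False using valid assms(3) M(4) by blast
  qed
qed

end
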